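(* Let $(\mathfrak{g}, [\cdot,\cdot]_{\mathfrak{g}}, \alpha_{\mathfrak{g}}, \langle\cdot,\cdot\rangle)$ be a Lorentzian (regular) Hom-Lie algebra. (i) If $\mathfrak{g}$ has positive sectional curvature on timelike planes, then it admits no non-trivial timelike Killing vector. (ii) If $\mathfrak{g}$ has non-negative sectional curvature on timelike planes, then every timelike Killing vector $v$ is parallel, i.e. $\nabla_x v=0$ for all $x\in\mathfrak{g}$.
   Context: A Hom-Lie algebra is a triple $(\mathfrak{g},[\cdot,\cdot]_{\mathfrak{g}},\alpha_{\mathfrak{g}})$ where $\mathfrak{g}$ is a (here finite-dimensional real) vector space, $[\cdot,\cdot]_{\mathfrak{g}}:\mathfrak{g}\times\mathfrak{g}\to\mathfrak{g}$ is a skew-symmetric bilinear map, and $\alpha_{\mathfrak{g}}:\mathfrak{g}\to\mathfrak{g}$ is a linear map with $\alpha_{\mathfrak{g}}([x,y]_{\mathfrak{g}})=[\alpha_{\mathfrak{g}}(x),\alpha_{\mathfrak{g}}(y)]_{\mathfrak{g}}$ for all $x,y$, such that the Hom-Jacobi identity $[\alpha_{\mathfrak{g}}(x),[y,z]_{\mathfrak{g}}]_{\mathfrak{g}}+[\alpha_{\mathfrak{g}}(y),[z,x]_{\mathfrak{g}}]_{\mathfrak{g}}+[\alpha_{\mathfrak{g}}(z),[x,y]_{\mathfrak{g}}]_{\mathfrak{g}}=0$ holds for all $x,y,z\in\mathfrak{g}$. It is regular if $\alpha_{\mathfrak{g}}$ is invertible; all Hom-Lie algebras are assumed regular. A pseudo-Riemannian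 Hom-Lie algebra is such a triple together with a non-degenerate symmetric bilinear form $\langle\cdot,\cdot\rangle:\mathfrak{g}\times\mathfrak{g}\to\mathbb{R}$ with $\langle\alpha_{\mathfrak{g}}(x),\alpha_{\mathfrak{g}}(y)\rangle=\langle x,y\rangle$ for all $x,y$. It is called Lorentzian if $\langle\cdot,\cdot\rangle$ has signature $(1,n-1)$, $n=\dim\mathfrak{g}$, meaning one negative and $n-1$ positive directions. A vector $v$ is timelike if $\langle v,v\rangle<0$. A timelike plane is a two-dimensional subspace on which $\langle\cdot,\cdot\rangle$ is non-degenerate and indefinite (equivalently $\langle x,x\rangle\langle y,y\rangle-\langle x,y\rangle^2<0$ for a basis $x,y$). The Hom-Levi-Civita connection is the unique bilinear map $\nabla:\mathfrak{g}\times\mathfrak{g}\to\mathfrak{g}$, $(x,y)\mapsto\nabla_x y$, given by the Koszul formula $$2\langle\nabla_x y,\alpha_{\mathfrak{g}}(z)\rangle=\langle[x,y]_{\mathfrak{g}},\alpha_{\mathfrak{g}}(z)\rangle+\langle[z,y]_{\mathfrak{g}},\alpha_{\mathfrak{g}}(x)\rangle+\langle[z,x]_{\mathfrak{g}},\alpha_{\mathfrak{g}}(y)\rangle$$ for all $x,y,z\in\mathfrak{g}$. It satisfies $[x,y]_{\mathfrak{g}}=\nabla_x y-\nabla_y x$, $\langle\nabla_x y,\alpha_{\mathfrak{g}}(z)\rangle=-\langle\alpha_{\mathfrak{g}}(y),\nabla_x z\rangle$ and $\alpha_{\mathfrak{g}}(\nabla_x y)=\nabla_{\alpha_{\mathfrak{g}}(x)}\alpha_{\mathfrak{g}}(y)$.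 The curvature tensor is $R(x,y)z=\nabla_{\alpha_{\mathfrak{g}}(x)}\nabla_y z-\nabla_{\alpha_{\mathfrak{g}}(y)}\nabla_x z-\nabla_{[x,y]_{\mathfrak{g}}}\alpha_{\mathfrak{g}}(z)$. For $x,y$ spanning a two-dimensional subspace on which $\langle\cdot,\cdot\rangle$ is non-degenerate, the sectional curvature is $$K(x,y)=\frac{\langle R(x,y)y,\alpha_{\mathfrak{g}}^2(x)\rangle}{\langle x,x\rangle\langle y,y\rangle-\langle x,y\rangle^2}.$$ Positive (respectively non-negative) sectional curvature on timelike planes means $K(x,y)>0$ (respectively $K(x,y)\ge 0$) whenever $x,y\in\mathfrak{g}$ span a timelike plane. A vector $v\in\mathfrak{g}$ is Killing if $\langle\nabla_x v,\alpha_{\mathfrak{g}}(y)\rangle=-\langle\nabla_y v,\alpha_{\mathfrak{g}}(x)\rangle$ for all $x,y\in\mathfrak{g}$; it is non-trivial if $v\neq 0$.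
   Formalization: Part (i) is stated for dim ≥ 2; in dimension 1 it fails, because the bracket and connection vanish, there are no timelike planes, and every nonzero vector is a timelike Killing vector. *)

theory Defs
  imports "HOL-Analysis.Analysis"
begin

locale regular_hom_lie_algebra =
  fixes bracket :: "'a::real_vector \<Rightarrow> 'a \<Rightarrow> 'a"
    and \<alpha> :: "'a \<Rightarrow> 'a"
  assumes finite_dimensional: "\<exists>B::'a set. finite B \<and> span B = UNIV"
    and bilinear_bracket: "bilinear bracket"
    and skew_bracket: "bracket x y = - bracket y x"
    and linear_alpha: "linear \<alpha>"
    and alpha_bracket: "\<alpha> (bracket x y) = bracket (\<alpha> x) (\<alpha> y)"
    and hom_jacobi:
      "bracket (\<alpha> x) (bracket y z) + bracket (\<alpha> y) (bracket z x) + bracket (\<alpha> z) (bracket x y) = 0"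
    and bij_alpha: "bij \<alpha>"

definition symmetric_form :: "('a::real_vector \<Rightarrow> 'a \<Rightarrow> real) \<Rightarrow> bool" where
  "symmetric_form g \<longleftrightarrow> bilinear g \<and> (\<forall>x y. g x y = g y x)"

definition nondegenerate_on :: "'a::real_vector set \<Rightarrow> ('a \<Rightarrow> 'a \<Rightarrow> real) \<Rightarrow> bool" where
  "nondegenerate_on S g \<longleftrightarrow> (\<forall>x\<in>S. (\<forall>y\<in>S. g x y = 0) \<longrightarrow> x = 0)"

definition indefinite_on :: "'a::real_vector set \<Rightarrow> ('a \<Rightarrow> 'a \<Rightarrow> real) \<Rightarrow> bool" where
  "indefinite_on S g \<longleftrightarrow> (\<exists>x\<in>S. g x x < 0) \<and> (\<exists>x\<in>S. g x x > 0)"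

text \<open>
  The signature is written \<open>(p, q)\<close> with the negative directions first, and is read off from an
  orthogonal basis. The condition \<open>p + q = card B\<close> excludes null basis vectors; by Sylvester's law
  of inertia \<open>p\<close> and \<open>q\<close> do not depend on \<open>B\<close>.
\<close>

definition has_signature :: "('a::real_vector \<Rightarrow> 'a \<Rightarrow> real) \<Rightarrow> nat \<Rightarrow> nat \<Rightarrow> bool" where
  "has_signature g p q \<longleftrightarrow>
    (\<exists>B. finite B \<and> independent B \<and> span B = UNIV \<and>
      (\<forall>x\<in>B. \<forall>y\<in>B. x \<noteq> y \<longrightarrow> g x y = 0) \<and>
      card {x\<in>B. g x x < 0} = p \<and> card {x\<in>B. g x x > 0} = q \<and> p + q = card B)"

definition timelike :: "('a::real_vector \<Rightarrow> 'a \<Rightarrow> real) \<Rightarrow> 'a \<Rightarrow> bool" where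
  "timelike g v \<longleftrightarrow> g v v < 0"

definition timelike_plane :: "('a::real_vector \<Rightarrow> 'a \<Rightarrow> real) \<Rightarrow> 'a set \<Rightarrow> bool" where
  "timelike_plane g P \<longleftrightarrow>
    subspace P \<and> dim P = 2 \<and> nondegenerate_on P g \<and> indefinite_on P g"

locale pseudo_riemannian_hom_lie_algebra = regular_hom_lie_algebra bracket \<alpha>
  for bracket :: "'a::real_vector \<Rightarrow> 'a \<Rightarrow> 'a" and \<alpha> :: "'a \<Rightarrow> 'a" +
  fixes g :: "'a \<Rightarrow> 'a \<Rightarrow> real"
  assumes symmetric_form: "symmetric_form g"
    and nondegenerate: "nondegenerate_on UNIV g"
    and alpha_isometry: "g (\<alpha> x) (\<alpha> y) = g x y"

locale lorentzian_hom_lie_algebra = pseudo_riemannian_hom_lie_algebra bracket \<alpha> g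
  for bracket :: "'a::real_vector \<Rightarrow> 'a \<Rightarrow> 'a" and \<alpha> :: "'a \<Rightarrow> 'a"
    and g :: "'a \<Rightarrow> 'a \<Rightarrow> real" +
  assumes signature: "has_signature g 1 (dim (UNIV :: 'a set) - 1)"

definition is_hom_levi_civita ::
    "('a::real_vector \<Rightarrow> 'a \<Rightarrow> 'a) \<Rightarrow> ('a \<Rightarrow> 'a) \<Rightarrow> ('a \<Rightarrow> 'a \<Rightarrow> real) \<Rightarrow>
      ('a \<Rightarrow> 'a \<Rightarrow> 'a) \<Rightarrow> bool" where
  "is_hom_levi_civita bracket \<alpha> g N \<longleftrightarrow> bilinear N \<and>
    (\<forall>x y z. 2 * g (N x y) (\<alpha> z) =
      g (bracket x y) (\<alpha> z) + g (bracket z y) (\<alpha> x) + g (bracket z x) (\<alpha> y))"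

text \<open>
  The description below is proper for every pseudo-Riemannian Hom-Lie algebra: existence and
  uniqueness are \<open>ex1_hom_levi_civita\<close>.
\<close>

definition nabla ::
    "('a::real_vector \<Rightarrow> 'a \<Rightarrow> 'a) \<Rightarrow> ('a \<Rightarrow> 'a) \<Rightarrow> ('a \<Rightarrow> 'a \<Rightarrow> real) \<Rightarrow>
      'a \<Rightarrow> 'a \<Rightarrow> 'a" where
  "nabla bracket \<alpha> g = (THE N. is_hom_levi_civita bracket \<alpha> g N)"

context pseudo_riemannian_hom_lie_algebra
begin

lemma bilinear_form: "bilinear g"
  using symmetric_form by (simp add: symmetric_form_def)

lemma form_determines: "u = w" if "\<And>z. g u (\<alpha> z) = g w (\<alpha> z)"
proof -
  have "g (u - w) y = 0" for y
  proof -
    obtain z where "y = \<alpha> z" using bij_alpha by (metis bij_pointE)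
    then show ?thesis using that bilinear_lsub[OF bilinear_form] by simp
  qed
  then have "u - w = 0" using nondegenerate unfolding nondegenerate_on_def by blast
  then show ?thesis by simp
qed

lemma form_represents: "\<exists>u. \<forall>z. g u (\<alpha> z) = f z" if f: "linear f" for f :: "'a \<Rightarrow> real"
proof -
  obtain C :: "'a set" where "finite C" "span C = UNIV"
    using finite_dimensional by blast
  moreover obtain B :: "'a set" where "independent B" "span B = UNIV"
    using basis_exists[of "UNIV :: 'a set"] by (metis top.extremum_uniqueI)
  ultimately have B: "finite B" "independent B" "span B = UNIV"
    using independent_span_bound[of C B] by auto
  interpret fd: finite_dimensional_vector_space "(*\<^sub>R) :: real \<Rightarrow> 'a \<Rightarrow> 'a" B
    using B by unfold_locales (auto simp: dependent_raw_def span_raw_def)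
  have lg: "linear (\<lambda>z. g u (\<alpha> z))" for u
    using bilinear_form linear_compose[OF linear_alpha] by (auto simp: bilinear_def o_def)
  define \<Phi> where "\<Phi> = (\<lambda>u. \<Sum>b\<in>B. g u (\<alpha> b) *\<^sub>R b)"
  have lin: "linear \<Phi>"
    unfolding \<Phi>_def
    by (rule linearI)
       (simp_all add: bilinear_ladd[OF bilinear_form] bilinear_lmul[OF bilinear_form]
         sum.distrib scaleR_left_distrib scaleR_sum_right)
  have coeff: "\<forall>b\<in>B. c b = d b" if "(\<Sum>b\<in>B. c b *\<^sub>R b) = (\<Sum>b\<in>B. d b *\<^sub>R b)"
    for c d :: "'a \<Rightarrow> real"
  proof -
    have "(\<Sum>b\<in>B. (c b - d b) *\<^sub>R b) = 0"
      using that by (simp add: scaleR_left_diff_distrib sum_subtractf)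
    then have "\<forall>b\<in>B. c b - d b = 0"
      using B real_vector.independentD[OF B(2,1) order_refl, of "\<lambda>b. c b - d b"] by blast
    then show ?thesis by simp
  qed
  have ext: "g u (\<alpha> z) = h z" if "linear h" "\<And>b. b \<in> B \<Longrightarrow> g u (\<alpha> b) = h b" for u z h
    using linear_eq_on_span[OF lg[of u] that(1), of B z] that(2) B(3) by auto
  have "inj \<Phi>"
  proof (rule injI)
    fix u w assume "\<Phi> u = \<Phi> w"
    then have "\<forall>b\<in>B. g u (\<alpha> b) = g w (\<alpha> b)" unfolding \<Phi>_def by (rule coeff)
    then have "g u (\<alpha> z) = g w (\<alpha> z)" for z using ext[OF lg] by blast
    then show "u = w" by (rule form_determines)
  qed
  then have "surj \<Phi>"
    using fd.linear_inj_imp_surj lin by (simp add: linear_def)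
  then obtain u where "\<Phi> u = (\<Sum>b\<in>B. f b *\<^sub>R b)" by (metis surjD)
  then have "\<forall>b\<in>B. g u (\<alpha> b) = f b" unfolding \<Phi>_def by (rule coeff)
  then show ?thesis using ext[OF f] by blast
qed

lemma ex1_hom_levi_civita: "\<exists>!N. is_hom_levi_civita bracket \<alpha> g N"
proof -
  define T where "T = (\<lambda>x y z. (g (bracket x y) (\<alpha> z) + g (bracket z y) (\<alpha> x)
      + g (bracket z x) (\<alpha> y)) / 2)"
  note lin = bilinear_ladd[OF bilinear_form] bilinear_radd[OF bilinear_form]
    bilinear_lmul[OF bilinear_form] bilinear_rmul[OF bilinear_form]
    bilinear_ladd[OF bilinear_bracket] bilinear_radd[OF bilinear_bracket]
    bilinear_lmul[OF bilinear_bracket] bilinear_rmul[OF bilinear_bracket]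
    linear_add[OF linear_alpha] linear_cmul[OF linear_alpha]
  have "linear (T x y)" for x y
    by (rule linearI) (simp_all add: T_def lin field_simps)
  then have "\<forall>x y. \<exists>u. \<forall>z. g u (\<alpha> z) = T x y z" using form_represents by blast
  then obtain N where N: "\<And>x y z. g (N x y) (\<alpha> z) = T x y z" by metis
  have "linear (N x)" for x
    by (rule linearI; rule form_determines) (simp_all add: N lin, simp_all add: T_def lin field_simps)
  moreover have "linear (\<lambda>x. N x y)" for y
    by (rule linearI; rule form_determines) (simp_all add: N lin, simp_all add: T_def lin field_simps)
  ultimately have "is_hom_levi_civita bracket \<alpha> g N"
    unfolding is_hom_levi_civita_def bilinear_def by (simp add: N T_def)
  moreover have "M = N" if "is_hom_levi_civita bracket \<alpha> g M" for M
    using that unfolding is_hom_levi_civita_def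
    by (intro ext form_determines) (simp add: N T_def field_simps)
  ultimately show ?thesis by blast
qed

lemma is_hom_levi_civita_nabla: "is_hom_levi_civita bracket \<alpha> g (nabla bracket \<alpha> g)"
  unfolding nabla_def by (rule theI'[OF ex1_hom_levi_civita])

end

definition curvature ::
    "('a::real_vector \<Rightarrow> 'a \<Rightarrow> 'a) \<Rightarrow> ('a \<Rightarrow> 'a) \<Rightarrow> ('a \<Rightarrow> 'a \<Rightarrow> real) \<Rightarrow>
      'a \<Rightarrow> 'a \<Rightarrow> 'a \<Rightarrow> 'a" where
  "curvature bracket \<alpha> g x y z =
    nabla bracket \<alpha> g (\<alpha> x) (nabla bracket \<alpha> g y z)
    - nabla bracket \<alpha> g (\<alpha> y) (nabla bracket \<alpha> g x z)
    - nabla bracket \<alpha> g (bracket x y) (\<alpha> z)"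

definition sectional_curvature ::
    "('a::real_vector \<Rightarrow> 'a \<Rightarrow> 'a) \<Rightarrow> ('a \<Rightarrow> 'a) \<Rightarrow> ('a \<Rightarrow> 'a \<Rightarrow> real) \<Rightarrow>
      'a \<Rightarrow> 'a \<Rightarrow> real" where
  "sectional_curvature bracket \<alpha> g x y =
    g (curvature bracket \<alpha> g x y y) (\<alpha> (\<alpha> x)) / (g x x * g y y - (g x y)\<^sup>2)"

definition positive_on_timelike_planes ::
    "('a::real_vector \<Rightarrow> 'a \<Rightarrow> 'a) \<Rightarrow> ('a \<Rightarrow> 'a) \<Rightarrow> ('a \<Rightarrow> 'a \<Rightarrow> real) \<Rightarrow> bool" where
  "positive_on_timelike_planes bracket \<alpha> g \<longleftrightarrow>
    (\<forall>x y. timelike_plane g (span {x, y}) \<longrightarrow> sectional_curvature bracket \<alpha> g x y > 0)"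

definition nonnegative_on_timelike_planes ::
    "('a::real_vector \<Rightarrow> 'a \<Rightarrow> 'a) \<Rightarrow> ('a \<Rightarrow> 'a) \<Rightarrow> ('a \<Rightarrow> 'a \<Rightarrow> real) \<Rightarrow> bool" where
  "nonnegative_on_timelike_planes bracket \<alpha> g \<longleftrightarrow>
    (\<forall>x y. timelike_plane g (span {x, y}) \<longrightarrow> sectional_curvature bracket \<alpha> g x y \<ge> 0)"

definition killing ::
    "('a::real_vector \<Rightarrow> 'a \<Rightarrow> 'a) \<Rightarrow> ('a \<Rightarrow> 'a) \<Rightarrow> ('a \<Rightarrow> 'a \<Rightarrow> real) \<Rightarrow> 'a \<Rightarrow> bool" where
  "killing bracket \<alpha> g v \<longleftrightarrow>
    (\<forall>x y. g (nabla bracket \<alpha> g x v) (\<alpha> y) = - g (nabla bracket \<alpha> g y v) (\<alpha> x))"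

definition parallel ::
    "('a::real_vector \<Rightarrow> 'a \<Rightarrow> 'a) \<Rightarrow> ('a \<Rightarrow> 'a) \<Rightarrow> ('a \<Rightarrow> 'a \<Rightarrow> real) \<Rightarrow> 'a \<Rightarrow> bool" where
  "parallel bracket \<alpha> g v \<longleftrightarrow> (\<forall>x. nabla bracket \<alpha> g x v = 0)"

end

theory Submission
  imports Defs
begin

text \<open>
  For a Killing vector \<open>v\<close> metricity gives \<open>\<nabla>\<^sub>x v \<bottom> \<alpha> v\<close>, hence \<open>\<nabla>\<^sub>v v = 0\<close>, and the curvature
  numerator collapses to \<open>\<langle>R(x,v)v, \<alpha>\<^sup>2 x\<rangle> = \<langle>\<nabla>\<^sub>x v, \<nabla>\<^sub>x v\<rangle>\<close>. If \<open>v\<close> is timelike then so is \<open>\<alpha> v\<close>,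
  and in Lorentzian signature its orthogonal complement is positive definite. So the numerator
  is non-negative and vanishes only where \<open>\<nabla>\<^sub>x v = 0\<close>, while the denominator is negative on a
  timelike plane.
\<close>

section \<open>Orthogonal complements of timelike vectors in signature \<open>(1, q)\<close>\<close>

lemma orthogonal_positive_on_span:
  fixes g :: "'a::real_vector \<Rightarrow> 'a \<Rightarrow> real"
  assumes bil: "bilinear g" and fin: "finite C"
    and orth: "\<And>x y. x \<in> C \<Longrightarrow> y \<in> C \<Longrightarrow> x \<noteq> y \<Longrightarrow> g x y = 0"
    and pos: "\<And>x. x \<in> C \<Longrightarrow> g x x > 0"
    and u: "u \<in> span C" and le: "g u u \<le> 0"
  shows "u = 0"
proof -
  obtain c where c: "u = (\<Sum>b\<in>C. c b *\<^sub>R b)"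
    using u by (auto simp: span_finite[OF fin])
  have "g u u = (\<Sum>(x, y)\<in>C \<times> C. g (c x *\<^sub>R x) (c y *\<^sub>R y))"
    unfolding c by (rule bilinear_sum[OF bil])
  also have "\<dots> = (\<Sum>x\<in>C. \<Sum>y\<in>C. c x * (c y * g x y))"
    by (simp add: sum.cartesian_product[symmetric] bilinear_lmul[OF bil] bilinear_rmul[OF bil]
        mult.left_commute)
  also have "\<dots> = (\<Sum>x\<in>C. \<Sum>y\<in>C. if y = x then (c x)\<^sup>2 * g x x else 0)"
    by (intro sum.cong refl) (auto simp: power2_eq_square orth)
  also have "\<dots> = (\<Sum>x\<in>C. (c x)\<^sup>2 * g x x)"
    using fin by simp
  finally have "(\<Sum>x\<in>C. (c x)\<^sup>2 * g x x) \<le> 0"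
    using le by simp
  moreover have nonneg: "(c x)\<^sup>2 * g x x \<ge> 0" if "x \<in> C" for x
    using pos[OF that] by simp
  ultimately have "(\<Sum>x\<in>C. (c x)\<^sup>2 * g x x) = 0"
    by (intro antisym sum_nonneg)
  then have "\<forall>x\<in>C. (c x)\<^sup>2 * g x x = 0"
    using nonneg by (simp add: sum_nonneg_eq_0_iff[OF fin])
  then have "c x = 0" if "x \<in> C" for x
    using that pos by fastforce
  then show ?thesis
    by (simp add: c)
qed

text \<open>Off its single negative vector \<open>e\<close>, the signature basis spans a hyperplane
  on which the form is positive definite. If \<open>g w w \<le> 0\<close>, the form would be nowhere
  positive on the span of \<open>v\<close> and \<open>w\<close>, and such a span cannot avoid that
  hyperplane.\<close>

lemma signature_one_orthogonal_timelike:
  fixes g :: "'a::real_vector \<Rightarrow> 'a \<Rightarrow> real"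
  assumes g: "symmetric_form g" and sig: "has_signature g 1 q"
    and v: "timelike g v" and vw: "g v w = 0" and w: "w \<noteq> 0"
  shows "g w w > 0"
proof (rule ccontr)
  assume "\<not> ?thesis"
  then have ww: "g w w \<le> 0" by simp
  have bil: "bilinear g" and sym: "\<And>x y. g x y = g y x"
    using g by (auto simp: symmetric_form_def)
  obtain B where B: "finite B" "span B = UNIV"
    and orth: "\<forall>x\<in>B. \<forall>y\<in>B. x \<noteq> y \<longrightarrow> g x y = 0"
    and one: "card {x\<in>B. g x x < 0} = 1"
    and card: "card {x\<in>B. g x x > 0} = q" "1 + q = card B"
    using sig unfolding has_signature_def by (elim exE conjE) (rule that)
  obtain e where e: "{x\<in>B. g x x < 0} = {e}"
    using one card_1_singletonE by blast
  \<comment> \<open>A count: \<open>1 + q = card B\<close> leaves no room for null basis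
    vectors.\<close>
  have "{x\<in>B. g x x < 0} \<union> {x\<in>B. g x x > 0} = B"
  proof (rule card_subset_eq[OF B(1)])
    show "card ({x\<in>B. g x x < 0} \<union> {x\<in>B. g x x > 0}) = card B"
      using B(1) one card by (subst card_Un_disjoint) auto
  qed blast
  then have pos: "g x x > 0" if "x \<in> B - {e}" for x
    using that e by blast
  have posdef: "u = 0" if "u \<in> span (B - {e})" "g u u \<le> 0" for u
    using orthogonal_positive_on_span[OF bil _ _ pos that] B(1) orth by blast
  have split: "\<exists>k. x - k *\<^sub>R e \<in> span (B - {e})" for x
    using span_breakdown[of e B x] e B(2) by blast
  obtain a where a: "v - a *\<^sub>R e \<in> span (B - {e})" using split by blast
  obtain c where c: "w - c *\<^sub>R e \<in> span (B - {e})" using split by blast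
  \<comment> \<open>The coefficients are chosen so that the \<open>e\<close>-components of
    \<open>v\<close> and \<open>w\<close> cancel. Both terms of \<open>g u u\<close> are
    non-positive, so \<open>u = 0\<close> and each term vanishes; then \<open>c = 0\<close>, which
    puts \<open>w\<close> itself into the hyperplane.\<close>
  define u where "u = c *\<^sub>R v - a *\<^sub>R w"
  have "u = c *\<^sub>R (v - a *\<^sub>R e) - a *\<^sub>R (w - c *\<^sub>R e)"
    by (simp add: u_def algebra_simps)
  then have u_span: "u \<in> span (B - {e})"
    using a c by (metis span_diff span_scale)
  have guu: "g u u = c\<^sup>2 * g v v + a\<^sup>2 * g w w"
    using vw sym[of w v]
    by (simp add: u_def bilinear_lsub[OF bil] bilinear_rsub[OF bil] bilinear_lmul[OF bil]
        bilinear_rmul[OF bil] power2_eq_square)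
  have nonpos: "c\<^sup>2 * g v v \<le> 0" "a\<^sup>2 * g w w \<le> 0"
    using v ww by (auto simp: timelike_def mult_le_0_iff)
  then have "u = 0"
    using posdef[OF u_span] guu by linarith
  then have "g u u = 0"
    by (simp add: bilinear_lzero[OF bil])
  then have "c\<^sup>2 * g v v = 0"
    using guu nonpos by linarith
  then have "c = 0"
    using v by (simp add: timelike_def)
  then show False
    using posdef[of w] c ww w by simp
qed

section \<open>The Hom-Levi-Civita connection and Killing vectors\<close>

context pseudo_riemannian_hom_lie_algebra
begin

abbreviation N where "N \<equiv> nabla bracket \<alpha> g"

lemma form_sym: "g x y = g y x"
  using symmetric_form by (simp add: symmetric_form_def)

lemma bilinear_nabla: "bilinear N"
  using is_hom_levi_civita_nabla by (simp add: is_hom_levi_civita_def)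

lemma koszul:
  "2 * g (N x y) (\<alpha> z) = g (bracket x y) (\<alpha> z) + g (bracket z y) (\<alpha> x) + g (bracket z x) (\<alpha> y)"
  using is_hom_levi_civita_nabla by (simp add: is_hom_levi_civita_def)

lemma bracket_swap: "g (bracket x y) z = - g (bracket y x) z"
  by (metis skew_bracket bilinear_lneg[OF bilinear_form])

text \<open>In the sum of the Koszul formulas for \<open>x, y, z\<close> and \<open>x, z, y\<close>
  the right-hand sides cancel in pairs by skew-symmetry of the bracket.\<close>

lemma nabla_metric: "g (N x y) (\<alpha> z) = - g (\<alpha> y) (N x z)"
  using koszul[of x y z] koszul[of x z y] form_sym[of "\<alpha> y" "N x z"]
    bracket_swap[of x y "\<alpha> z"] bracket_swap[of x z "\<alpha> y"] bracket_swap[of y z "\<alpha> x"]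
  by linarith

lemma nabla_torsion_free: "bracket x y = N x y - N y x"
proof (rule form_determines)
  fix z
  show "g (bracket x y) (\<alpha> z) = g (N x y - N y x) (\<alpha> z)"
    using koszul[of x y z] koszul[of y x z] bracket_swap[of x y "\<alpha> z"]
    by (simp add: bilinear_lsub[OF bilinear_form])
qed

lemma alpha_nabla: "\<alpha> (N x y) = N (\<alpha> x) (\<alpha> y)"
proof (rule form_determines)
  fix z
  \<comment> \<open>With the test vector written as \<open>\<alpha> (\<alpha> z')\<close>, every
    entry of the second Koszul formula carries one more \<open>\<alpha>\<close> than in the first,
    and the isometry removes it.\<close>
  obtain z' where z: "z = \<alpha> z'" using bij_alpha by (metis bij_pointE)
  show "g (\<alpha> (N x y)) (\<alpha> z) = g (N (\<alpha> x) (\<alpha> y)) (\<alpha> z)"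
    using koszul[of x y z'] koszul[of "\<alpha> x" "\<alpha> y" "\<alpha> z'"]
    by (simp add: z alpha_isometry flip: alpha_bracket)
qed

text \<open>Needed because the last term of the curvature differentiates \<open>\<alpha> v\<close>
  instead of \<open>v\<close>.\<close>

lemma killing_alpha:
  assumes v: "killing bracket \<alpha> g v"
  shows "killing bracket \<alpha> g (\<alpha> v)"
  unfolding killing_def
proof (intro allI)
  fix x y
  obtain x' y' where xy: "x = \<alpha> x'" "y = \<alpha> y'" using bij_alpha by (metis bij_pointE)
  have "g (N x' v) (\<alpha> y') = - g (N y' v) (\<alpha> x')"
    using v unfolding killing_def by blast
  then show "g (N x (\<alpha> v)) (\<alpha> y) = - g (N y (\<alpha> v)) (\<alpha> x)"
    unfolding xy by (simp only: alpha_isometry flip: alpha_nabla)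
qed

lemma nabla_orthogonal: "g (\<alpha> v) (N x v) = 0"
  using nabla_metric[of x v v] form_sym[of "\<alpha> v" "N x v"] by simp

text \<open>The Killing equation trades \<open>N v v\<close> tested against
  \<open>\<alpha> z\<close> for \<open>N z v\<close> tested against \<open>\<alpha> v\<close>, which
  metricity makes zero.\<close>

lemma killing_nabla_self:
  assumes v: "killing bracket \<alpha> g v"
  shows "N v v = 0"
proof (rule form_determines)
  fix z
  have "g (N v v) (\<alpha> z) = - g (N z v) (\<alpha> v)"
    using v unfolding killing_def by blast
  then show "g (N v v) (\<alpha> z) = g 0 (\<alpha> z)"
    using nabla_orthogonal[of v z] form_sym[of "\<alpha> v" "N z v"]
    by (simp add: bilinear_lzero[OF bilinear_form])
qed

text \<open>The first curvature term dies with \<open>N v v\<close>. Metricity treats the second,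
  the Killing equation of \<open>\<alpha> v\<close> the third; after expanding the bracket by
  torsion-freeness, the two products of \<open>N x v\<close> with \<open>N v x\<close>
  cancel.\<close>

lemma killing_curvature:
  assumes v: "killing bracket \<alpha> g v"
  shows "g (curvature bracket \<alpha> g x v v) (\<alpha> (\<alpha> x)) = g (N x v) (N x v)"
proof -
  have 1: "g (N (\<alpha> v) (N x v)) (\<alpha> (\<alpha> x)) = - g (N x v) (N v x)"
    using nabla_metric[of "\<alpha> v" "N x v" "\<alpha> x"] by (simp add: alpha_isometry flip: alpha_nabla)
  have "g (N (bracket x v) (\<alpha> v)) (\<alpha> (\<alpha> x)) = - g (N (\<alpha> x) (\<alpha> v)) (\<alpha> (bracket x v))"
    using killing_alpha[OF v] unfolding killing_def by blast
  also have "\<dots> = - g (N x v) (bracket x v)"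
    by (simp add: alpha_isometry flip: alpha_nabla)
  also have "\<dots> = - g (N x v) (N x v) + g (N x v) (N v x)"
    by (simp add: nabla_torsion_free bilinear_rsub[OF bilinear_form])
  finally show ?thesis
    using 1 by (simp add: curvature_def killing_nabla_self[OF v] bilinear_rzero[OF bilinear_nabla]
        bilinear_lzero[OF bilinear_form] bilinear_lsub[OF bilinear_form]
        bilinear_lneg[OF bilinear_form])
qed

end

section \<open>Timelike planes and the sign of the sectional curvature\<close>

context lorentzian_hom_lie_algebra
begin

lemma orthogonal_timelike:
  assumes "timelike g v" "g v w = 0" "w \<noteq> 0"
  shows "g w w > 0"
  using signature_one_orthogonal_timelike[OF symmetric_form signature assms] .

text \<open>Gram-Schmidt: replacing \<open>x\<close> by its component \<open>w\<close> orthogonal to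
  \<open>v\<close> keeps the plane and the Gram determinant, which becomes
  \<open>g w w * g v v\<close> with factors of opposite sign.\<close>

lemma timelike_pair:
  assumes v: "timelike g v" and x: "x \<notin> span {v}"
  shows "timelike_plane g (span {x, v})" and "g x x * g v v - (g x v)\<^sup>2 < 0"
proof -
  note lin = bilinear_ladd[OF bilinear_form] bilinear_lsub[OF bilinear_form]
    bilinear_lmul[OF bilinear_form] bilinear_radd[OF bilinear_form]
    bilinear_rsub[OF bilinear_form] bilinear_rmul[OF bilinear_form]
  have vv: "g v v < 0" using v by (simp add: timelike_def)
  then have "v \<noteq> 0" by (auto simp: bilinear_lzero[OF bilinear_form])
  define k where "k = g x v / g v v"
  define w where "w = x - k *\<^sub>R v"
  have kv: "k * g v v = g x v" using vv by (simp add: k_def)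
  have vw: "g v w = 0"
    using kv form_sym[of v x] by (simp add: w_def lin)
  have "w \<noteq> 0"
    using x by (auto simp: w_def span_singleton)
  then have ww: "g w w > 0"
    using orthogonal_timelike[OF v vw] by blast
  have "g w w = g x w - k * g v w"
    using bilinear_lsub[OF bilinear_form, of x "k *\<^sub>R v" w]
    by (simp add: bilinear_lmul[OF bilinear_form] flip: w_def)
  then have "g w w = g x w"
    using vw by simp
  also have "\<dots> = g x x - k * g x v"
    by (simp add: w_def lin)
  finally have gww: "g w w = g x x - k * g x v" .
  have "g w w * g v v = g x x * g v v - g x v * (k * g v v)"
    unfolding gww by (simp add: algebra_simps)
  then have "g x x * g v v - (g x v)\<^sup>2 = g w w * g v v"
    by (simp add: kv power2_eq_square)
  also have "\<dots> < 0" using ww vv by (simp add: mult_pos_neg)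
  finally show "g x x * g v v - (g x v)\<^sup>2 < 0" .
  have vP: "v \<in> span {x, v}" and wP: "w \<in> span {x, v}"
    unfolding w_def by (intro span_diff span_scale span_base; simp)+
  have "independent {x, v}"
    using x \<open>v \<noteq> 0\<close> by (simp add: independent_insert)
  moreover have "x \<noteq> v" using x span_base by blast
  ultimately have dim: "dim (span {x, v}) = 2"
    by (simp add: dim_eq_card_independent)
  have "nondegenerate_on (span {x, v}) g"
    unfolding nondegenerate_on_def
  proof (intro ballI impI)
    fix y assume y: "y \<in> span {x, v}" and 0: "\<forall>z\<in>span {x, v}. g y z = 0"
    \<comment> \<open>A vector in the radical of the plane is both null and orthogonal to
      \<open>v\<close>, so it must be zero.\<close>
    have "g v y = 0" using 0 vP form_sym by metis
    moreover have "g y y = 0" using 0 y by blast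
    ultimately show "y = 0" using orthogonal_timelike[OF v] by force
  qed
  moreover have "indefinite_on (span {x, v}) g"
    unfolding indefinite_on_def using vP wP vv ww by blast
  ultimately show "timelike_plane g (span {x, v})"
    using dim by (simp add: timelike_plane_def)
qed

lemma killing_numerator_pos:
  assumes v: "timelike g v" and k: "killing bracket \<alpha> g v" and nz: "N x v \<noteq> 0"
  shows "g (curvature bracket \<alpha> g x v v) (\<alpha> (\<alpha> x)) > 0"
proof -
  have "timelike g (\<alpha> v)" using v by (simp add: timelike_def alpha_isometry)
  then show ?thesis
    using orthogonal_timelike nabla_orthogonal nz by (simp add: killing_curvature[OF k])
qed

lemma killing_sectional_curvature_nonpos:
  assumes v: "timelike g v" and k: "killing bracket \<alpha> g v" and x: "x \<notin> span {v}"
  shows "sectional_curvature bracket \<alpha> g x v \<le> 0"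
    and "N x v \<noteq> 0 \<Longrightarrow> sectional_curvature bracket \<alpha> g x v < 0"
proof -
  note den = timelike_pair(2)[OF v x]
  show neg: "sectional_curvature bracket \<alpha> g x v < 0" if "N x v \<noteq> 0"
    using killing_numerator_pos[OF v k that] den
    by (simp add: sectional_curvature_def divide_pos_neg)
  show "sectional_curvature bracket \<alpha> g x v \<le> 0"
  proof (cases "N x v = 0")
    case True
    then show ?thesis
      by (simp add: sectional_curvature_def killing_curvature[OF k] bilinear_lzero[OF bilinear_form])
  next
    case False
    then show ?thesis using neg by simp
  qed
qed

text \<open>The dimension bound supplies an \<open>x\<close> outside the line of \<open>v\<close>.
  In dimension one there are no planes, so the curvature condition is vacuous, while the bracket and
  \<open>N\<close> vanish and every vector is Killing.\<close>

lemma no_timelike_killing: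
  assumes "2 \<le> dim (UNIV :: 'a set)" and pos: "positive_on_timelike_planes bracket \<alpha> g"
    and v: "timelike g v"
  shows "\<not> killing bracket \<alpha> g v"
proof
  assume k: "killing bracket \<alpha> g v"
  have "span {v} \<noteq> UNIV"
    using dim_le_card[of UNIV "{v}"] assms(1) by auto
  then obtain x where x: "x \<notin> span {v}" by blast
  then have "sectional_curvature bracket \<alpha> g x v > 0"
    using pos timelike_pair(1)[OF v x] by (simp add: positive_on_timelike_planes_def)
  then show False
    using killing_sectional_curvature_nonpos(1)[OF v k x] by simp
qed

lemma timelike_killing_parallel:
  assumes nn: "nonnegative_on_timelike_planes bracket \<alpha> g"
    and v: "timelike g v" and k: "killing bracket \<alpha> g v"
  shows "parallel bracket \<alpha> g v"
  unfolding parallel_def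
proof
  fix x
  show "N x v = 0"
  \<comment> \<open>Curvature says nothing along \<open>v\<close> itself; that direction is covered
    by \<open>N v v = 0\<close>. Elsewhere a non-zero \<open>N x v\<close> would make the curvature
    of the timelike plane negative.\<close>
  proof (cases "x \<in> span {v}")
    case True
    then obtain c where "x = c *\<^sub>R v" by (auto simp: span_singleton)
    then show ?thesis
      by (simp add: bilinear_lmul[OF bilinear_nabla] killing_nabla_self[OF k])
  next
    case False
    then have "sectional_curvature bracket \<alpha> g x v \<ge> 0"
      using nn timelike_pair(1)[OF v] by (simp add: nonnegative_on_timelike_planes_def)
    then show ?thesis
      using killing_sectional_curvature_nonpos(2)[OF v k False] by fastforce
  qed
qed

end

theorem theorem12:
  fixes bracket :: "'a::real_vector \<Rightarrow> 'a \<Rightarrow> 'a"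
    and \<alpha> :: "'a \<Rightarrow> 'a"
    and g :: "'a \<Rightarrow> 'a \<Rightarrow> real"
  assumes "lorentzian_hom_lie_algebra bracket \<alpha> g"
  shows "(2 \<le> dim (UNIV :: 'a set) \<longrightarrow> positive_on_timelike_planes bracket \<alpha> g \<longrightarrow>
            \<not> (\<exists>v. v \<noteq> 0 \<and> timelike g v \<and> killing bracket \<alpha> g v))
       \<and> (nonnegative_on_timelike_planes bracket \<alpha> g \<longrightarrow>
            (\<forall>v. timelike g v \<and> killing bracket \<alpha> g v \<longrightarrow> parallel bracket \<alpha> g v))"
proof -
  interpret lorentzian_hom_lie_algebra bracket \<alpha> g by (rule assms)
  show ?thesis
    using no_timelike_killing timelike_killing_parallel by blast
qed

end
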